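(* Let $F:\mathbb{R}^n\to\mathbb{R}$ be given by $F(x_1,\dots,x_n)=\sum_{i=1}^n a_i x_i^2+bx_n+c$ with $a_i\in\{-1,0,1\}$ and $b,c\in\mathbb{R}$, and let $\Omega\subset\mathbb{R}^n$ be one of the two open sets $\{F<1\}$, $\{F>1\}$ with boundary $\partial\Omega=F^{-1}(1)$. If $a_n=0\neq b$, then there does not exist any immersed minimal hypersurface in $\overline\Omega$ with free boundary on $\partial\Omega$.
   Context: Hypersurfaces $\Sigma$ are compact, smooth, immersed, of dimension $n-1$, contained in $\overline{\Omega}$, with boundary $\partial\Sigma\subset\partial\Omega$. $\Sigma$ has free boundary on $\partial\Omega$ if it meets $\partial\Omega$ orthogonally along $\partial\Sigma$, i.e. the outward unit conormal of $\partial\Sigma$ in $\Sigma$ equals the outward unit normal of $\Omega$ along $\partial\Sigma$. *)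

theory Defs
  imports "HOL-Analysis.Analysis"
begin

section \<open>Smooth maps\<close>

fun Ck_on :: "nat \<Rightarrow> ('a::euclidean_space \<Rightarrow> 'b::real_normed_vector) \<Rightarrow> 'a set \<Rightarrow> bool" where
  "Ck_on 0 f W \<longleftrightarrow> continuous_on W f"
| "Ck_on (Suc k) f W \<longleftrightarrow>
     (\<forall>x\<in>W. f differentiable at x) \<and> (\<forall>v. Ck_on k (\<lambda>x. frechet_derivative f (at x) v) W)"

text \<open>
  Smoothness on an arbitrary subset of a Euclidean space means local extendability to a smooth
  map on an open set, as is usual for relatively open subsets of a half-space. On an open
  set this is ordinary smoothness.
\<close>

definition smooth_on :: "'a::euclidean_space set \<Rightarrow> ('a \<Rightarrow> 'b::real_normed_vector) \<Rightarrow> bool" where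
  "smooth_on S f \<longleftrightarrow>
     (\<forall>x\<in>S. \<exists>W g. open W \<and> x \<in> W \<and> (\<forall>k. Ck_on k g W) \<and> (\<forall>y\<in>S \<inter> W. g y = f y))"


section \<open>Compact smooth manifolds with boundary\<close>

definition half_space :: "'d::finite \<Rightarrow> (real ^ 'd) set" where
  "half_space j = {x. 0 \<le> x $ j}"

type_synonym ('m, 'd) chart = "'m set \<times> ('m \<Rightarrow> real ^ 'd)"

definition is_chart :: "'d::finite \<Rightarrow> 'm topology \<Rightarrow> ('m, 'd) chart \<Rightarrow> bool" where
  "is_chart j M = (\<lambda>(U, \<psi>). openin M U \<and>
     openin (top_of_set (half_space j)) (\<psi> ` U) \<and>
     homeomorphic_map (subtopology M U) (top_of_set (\<psi> ` U)) \<psi>)"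

text \<open>
  The dimension is \<open>CARD('d)\<close>, hence at least 1. Second countability is not listed
  because it follows from compactness and the existence of charts.
\<close>

definition compact_smooth_manifold ::
  "'d::finite \<Rightarrow> 'm topology \<Rightarrow> ('m, 'd) chart set \<Rightarrow> bool" where
  "compact_smooth_manifold j M \<A> \<longleftrightarrow>
     compact_space M \<and> Hausdorff_space M \<and>
     (\<forall>c\<in>\<A>. is_chart j M c) \<and> (\<Union>(U, \<psi>)\<in>\<A>. U) = topspace M \<and>
     (\<forall>(U, \<psi>)\<in>\<A>. \<forall>(V, \<psi>')\<in>\<A>. smooth_on (\<psi> ` (U \<inter> V)) (\<psi>' \<circ> inv_into U \<psi>))"

text \<open>
  By invariance of domain, whether a point is sent to the bounding hyperplane of the half-space
  does not depend on the chart.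
\<close>

definition manifold_boundary :: "'d::finite \<Rightarrow> ('m, 'd) chart set \<Rightarrow> 'm set" where
  "manifold_boundary j \<A> = {p. \<exists>(U, \<psi>)\<in>\<A>. p \<in> U \<and> \<psi> p $ j = 0}"


section \<open>Immersed hypersurfaces\<close>

text \<open>
  The derivatives below are taken within the chart image \<open>S\<close>; they are unique, also at
  boundary points, since \<open>S\<close> is relatively open in a half-space.
\<close>

definition local_param :: "('m \<Rightarrow> real ^ 'n) \<Rightarrow> ('m, 'd) chart \<Rightarrow> real ^ 'd \<Rightarrow> real ^ 'n" where
  "local_param \<phi> = (\<lambda>(U, \<psi>). \<phi> \<circ> inv_into U \<psi>)"

definition chart_image :: "('m, 'd) chart \<Rightarrow> (real ^ 'd) set" where
  "chart_image = (\<lambda>(U, \<psi>). \<psi> ` U)"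

definition immersed_hypersurface ::
  "'d::finite \<Rightarrow> 'm topology \<Rightarrow> ('m, 'd) chart set \<Rightarrow> ('m \<Rightarrow> real ^ 'n::finite) \<Rightarrow> bool" where
  "immersed_hypersurface j M \<A> \<phi> \<longleftrightarrow>
     compact_smooth_manifold j M \<A> \<and> topspace M \<noteq> {} \<and> CARD('n) = CARD('d) + 1 \<and>
     (\<forall>c\<in>\<A>. smooth_on (chart_image c) (local_param \<phi> c) \<and>
       (\<forall>x\<in>chart_image c.
          inj (frechet_derivative (local_param \<phi> c) (at x within chart_image c))))"

definition partial_deriv ::
  "(real ^ 'd) set \<Rightarrow> 'd::finite \<Rightarrow> (real ^ 'd \<Rightarrow> real ^ 'n::finite) \<Rightarrow> real ^ 'd \<Rightarrow> real ^ 'n" where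
  "partial_deriv S i X x = frechet_derivative X (at x within S) (axis i 1)"

definition first_fundamental_form ::
  "(real ^ 'd::finite) set \<Rightarrow> (real ^ 'd \<Rightarrow> real ^ 'n::finite) \<Rightarrow> real ^ 'd \<Rightarrow> real ^ 'd ^ 'd" where
  "first_fundamental_form S X x = (\<chi> i k. partial_deriv S i X x \<bullet> partial_deriv S k X x)"

definition second_fundamental_form ::
  "(real ^ 'd::finite) set \<Rightarrow> (real ^ 'd \<Rightarrow> real ^ 'n::finite) \<Rightarrow> real ^ 'n \<Rightarrow> real ^ 'd \<Rightarrow> real ^ 'd ^ 'd"
  where
  "second_fundamental_form S X \<nu> x =
     (\<chi> i k. partial_deriv S i (partial_deriv S k X) x \<bullet> \<nu>)"

definition unit_normal ::
  "(real ^ 'd::finite) set \<Rightarrow> (real ^ 'd \<Rightarrow> real ^ 'n::finite) \<Rightarrow> real ^ 'd \<Rightarrow> real ^ 'n \<Rightarrow> bool" where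
  "unit_normal S X x \<nu> \<longleftrightarrow> norm \<nu> = 1 \<and> (\<forall>i. partial_deriv S i X x \<bullet> \<nu> = 0)"

definition mean_curvature ::
  "(real ^ 'd::finite) set \<Rightarrow> (real ^ 'd \<Rightarrow> real ^ 'n::finite) \<Rightarrow> real ^ 'n \<Rightarrow> real ^ 'd \<Rightarrow> real" where
  "mean_curvature S X \<nu> x =
     trace (matrix_inv (first_fundamental_form S X x) ** second_fundamental_form S X \<nu> x)"

text \<open>
  At each point the unit normal is determined up to sign, which does not affect the vanishing
  of the mean curvature; so no orientation is needed.
\<close>

definition minimal :: "('m, 'd::finite) chart set \<Rightarrow> ('m \<Rightarrow> real ^ 'n::finite) \<Rightarrow> bool" where
  "minimal \<A> \<phi> \<longleftrightarrow>
     (\<forall>c\<in>\<A>. \<forall>x\<in>chart_image c. \<forall>\<nu>.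
        unit_normal (chart_image c) (local_param \<phi> c) x \<nu> \<longrightarrow>
        mean_curvature (chart_image c) (local_param \<phi> c) \<nu> x = 0)"


section \<open>Free boundary\<close>

text \<open>
  At a point of the bounding hyperplane, the tangent space of the boundary is the image of
  \<open>{w. w $ j = 0}\<close>, and vectors with \<open>w $ j < 0\<close> point out of the half-space.
\<close>

definition outward_unit_conormal ::
  "'d::finite \<Rightarrow> (real ^ 'd) set \<Rightarrow> (real ^ 'd \<Rightarrow> real ^ 'n::finite) \<Rightarrow> real ^ 'd \<Rightarrow> real ^ 'n \<Rightarrow> bool"
  where
  "outward_unit_conormal j S X x \<eta> \<longleftrightarrow>
     (let D = frechet_derivative X (at x within S)
      in norm \<eta> = 1 \<and> (\<exists>w. w $ j < 0 \<and> \<eta> = D w) \<and> (\<forall>w. w $ j = 0 \<longrightarrow> \<eta> \<bullet> D w = 0))"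

text \<open>
  Near \<open>q\<close>, the open set \<open>\<Omega>\<close> is the negativity set of a local defining function.
\<close>

definition outward_unit_normal :: "(real ^ 'n::finite) set \<Rightarrow> real ^ 'n \<Rightarrow> real ^ 'n \<Rightarrow> bool" where
  "outward_unit_normal \<Omega> q N \<longleftrightarrow>
     (\<exists>W \<rho> G. open W \<and> q \<in> W \<and> smooth_on W (\<rho> :: real ^ 'n \<Rightarrow> real) \<and> \<rho> q = 0 \<and>
        \<Omega> \<inter> W = {y \<in> W. \<rho> y < 0} \<and> GDERIV \<rho> q :> G \<and> G \<noteq> 0 \<and> N = G /\<^sub>R norm G)"

text \<open>
  Conormal and normal are unique whenever they exist, so the following says that they
  exist and coincide at every boundary point.
\<close>

definition free_boundary ::
  "'d::finite \<Rightarrow> ('m, 'd) chart set \<Rightarrow> ('m \<Rightarrow> real ^ 'n::finite) \<Rightarrow> (real ^ 'n) set \<Rightarrow> bool" where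
  "free_boundary j \<A> \<phi> \<Omega> \<longleftrightarrow>
     (\<forall>(U, \<psi>)\<in>\<A>. \<forall>p\<in>U. \<psi> p $ j = 0 \<longrightarrow>
        (\<exists>\<eta>. outward_unit_conormal j (chart_image (U, \<psi>)) (local_param \<phi> (U, \<psi>)) (\<psi> p) \<eta> \<and>
             outward_unit_normal \<Omega> (\<phi> p) \<eta>))"

end

theory Submission
  imports Defs
begin

text \<open>
  On a minimal hypersurface the coordinate functions are harmonic, and by the free boundary
  condition the conormal derivative of \<open>x\<^sub>n\<close> is the \<open>n\<close>-th component of \<open>\<plusminus>\<nabla>F / |\<nabla>F|\<close>, namely
  \<open>\<plusminus>b / |\<nabla>F|\<close>, which is bounded away from zero and has constant sign on the boundary. So, up to
  sign, \<open>x\<^sub>n\<close> has negative outward derivative along the boundary, and for small \<open>\<epsilon> > 0\<close> so does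
  \<open>v = x\<^sub>n + \<epsilon>|x|\<^sup>2\<close>. The maximum of \<open>v\<close> over the compact hypersurface is then not attained on the
  boundary, nor in the interior, since \<open>\<Delta>v = 2(n-1)\<epsilon> > 0\<close>; an empty boundary is not a special case.
\<close>

section \<open>Derivative tests\<close>

text \<open>Restriction to the ray \<open>t \<mapsto> x + t v\<close> reduces this to the
  one-variable test. Everything is relative to \<open>S\<close>, so the test also applies at
  boundary points of a chart image.\<close>

lemma has_derivative_pos_inc_direction:
  fixes f :: "'a::real_normed_vector \<Rightarrow> real"
  assumes f: "(f has_derivative f') (at x within S)" and pos: "0 < f' v"
  shows "\<exists>d>0. \<forall>t. 0 < t \<longrightarrow> t < d \<longrightarrow> x + t *\<^sub>R v \<in> S \<longrightarrow> f x < f (x + t *\<^sub>R v)"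
proof -
  let ?T = "{t. x + t *\<^sub>R v \<in> S}" and ?\<gamma> = "\<lambda>t. x + t *\<^sub>R v"
  have \<gamma>: "(?\<gamma> has_derivative (\<lambda>t. t *\<^sub>R v)) (at 0 within ?T)"
    by (auto intro!: derivative_eq_intros)
  have "(f has_derivative f') (at (?\<gamma> 0) within ?\<gamma> ` ?T)"
    using f by (auto intro: has_derivative_subset)
  from diff_chain_within[OF \<gamma> this]
  have "((\<lambda>t. f (?\<gamma> t)) has_derivative (\<lambda>t. f' (t *\<^sub>R v))) (at 0 within ?T)"
    by (simp add: o_def)
  moreover have "f' (t *\<^sub>R v) = f' v * t" for t
    using has_derivative_linear[OF f] by (simp add: linear_cmul)
  ultimately have "((\<lambda>t. f (?\<gamma> t)) has_real_derivative f' v) (at 0 within ?T)"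
    by (simp add: has_field_derivative_def)
  from has_real_derivative_pos_inc_right[OF this pos] show ?thesis
    by auto
qed

text \<open>If \<open>c\<close> were positive, then \<open>h'\<close>, which vanishes at the
  maximum, would be positive just to the right of 0 and \<open>h\<close> would increase
  there.\<close>

lemma DERIV2_nonpos_at_local_max:
  fixes h h' :: "real \<Rightarrow> real"
  assumes "0 < d"
    and h: "\<And>t. \<bar>t\<bar> < d \<Longrightarrow> (h has_real_derivative h' t) (at t)"
    and h': "(h' has_real_derivative c) (at 0)"
    and max: "\<And>t. \<bar>t\<bar> < d \<Longrightarrow> h t \<le> h 0"
  shows "c \<le> 0"
proof (rule ccontr)
  assume "\<not> c \<le> 0"
  have "(h has_real_derivative h' 0) (at 0)"
    using h \<open>0 < d\<close> by simp
  then have "h' 0 = 0"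
    using \<open>0 < d\<close> by (rule DERIV_local_max) (use max in auto)
  with DERIV_pos_inc_right[OF h'] \<open>\<not> c \<le> 0\<close> obtain e
    where "e > 0" and e: "\<And>t. 0 < t \<Longrightarrow> t < e \<Longrightarrow> 0 < h' t"
    by auto
  define t where "t = min d e / 2"
  have t: "0 < t" "t < d" "t < e"
    using \<open>0 < d\<close> \<open>e > 0\<close> by (auto simp: t_def)
  have "h 0 < h t"
  proof (rule DERIV_pos_imp_increasing_open[OF t(1)])
    show "\<exists>y. (h has_real_derivative y) (at s) \<and> 0 < y" if "0 < s" "s < t" for s
      using that t h[of s] e[of s] by (intro exI[of _ "h' s"]) auto
    show "continuous_on {0..t} h"
    proof (rule DERIV_continuous_on)
      show "(h has_real_derivative h' s) (at s within {0..t})" if "s \<in> {0..t}" for s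
        using h[of s] that t by (auto intro: has_field_derivative_at_within)
    qed
  qed
  with max[of t] t show False by simp
qed

text \<open>The definition of the normal allows any local defining function \<open>\<rho>\<close>;
  this ties it to the given \<open>f\<close>. A direction that decreases \<open>\<rho>\<close>
  enters the set, so it cannot increase \<open>f\<close>. Hence \<open>v \<bullet> G < 0\<close>
  implies \<open>v \<bullet> H \<le> 0\<close>, which forces \<open>H\<close> to be a positive
  multiple of \<open>G\<close>.\<close>

lemma outward_unit_normal_sublevel:
  assumes N: "outward_unit_normal {y. f y < 0} q N"
    and q: "f q = 0" and f: "GDERIV f q :> H" and "H \<noteq> 0"
  shows "N = H /\<^sub>R norm H"
proof -
  from N obtain W \<rho> G where W: "open W" "q \<in> W" and "\<rho> q = 0"
    and eq: "{y. f y < 0} \<inter> W = {y \<in> W. \<rho> y < 0}"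
    and \<rho>: "GDERIV \<rho> q :> G" and G: "G \<noteq> 0" and N_eq: "N = G /\<^sub>R norm G"
    unfolding outward_unit_normal_def by blast
  have *: "v \<bullet> H \<le> 0" if v: "v \<bullet> G < 0" for v
  proof (rule ccontr)
    assume "\<not> v \<bullet> H \<le> 0"
    then obtain d1 where "d1 > 0" and d1: "\<And>t. 0 < t \<Longrightarrow> t < d1 \<Longrightarrow> 0 < f (q + t *\<^sub>R v)"
      using has_derivative_pos_inc_direction[OF f[unfolded gderiv_def], of v] q by auto
    have "((\<lambda>y. - \<rho> y) has_derivative (\<lambda>h. - (h \<bullet> G))) (at q)"
      using \<rho> by (auto simp: gderiv_def intro: has_derivative_minus)
    from has_derivative_pos_inc_direction[OF this, of v] v \<open>\<rho> q = 0\<close>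
    obtain d2 where "d2 > 0" and d2: "\<And>t. 0 < t \<Longrightarrow> t < d2 \<Longrightarrow> \<rho> (q + t *\<^sub>R v) < 0"
      by auto
    have "((\<lambda>t. q + t *\<^sub>R v) \<longlongrightarrow> q + 0 *\<^sub>R v) (at_right 0)"
      by (intro tendsto_intros)
    then have "\<forall>\<^sub>F t in at_right 0. q + t *\<^sub>R v \<in> W"
      using W by (auto intro: topological_tendstoD)
    moreover have "\<forall>\<^sub>F t in at_right 0. t < d1 \<and> t < d2 \<and> (0::real) < t"
      using \<open>d1 > 0\<close> \<open>d2 > 0\<close>
      by (intro eventually_conj eventually_at_right_less)
        (auto intro: eventually_at_rightI[of 0])
    ultimately have "\<forall>\<^sub>F t in at_right (0::real). False"
    proof eventually_elim
      case (elim t)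
      then have "q + t *\<^sub>R v \<in> {y. f y < 0}"
        using eq d2 by blast
      with d1[of t] elim show False by auto
    qed
    then show False by simp
  qed
  have **: "v \<bullet> H \<le> 0" if v: "v \<bullet> G = 0" for v
  proof -
    \<comment> \<open>Tilting \<open>v\<close> slightly towards \<open>- G\<close> brings it under
      the strict case; the limit recovers \<open>v\<close>.\<close>
    have "((\<lambda>e. (v - e *\<^sub>R G) \<bullet> H) \<longlongrightarrow> (v - 0 *\<^sub>R G) \<bullet> H) (at_right (0::real))"
      by (intro tendsto_intros)
    moreover have "\<forall>\<^sub>F e in at_right (0::real). (v - e *\<^sub>R G) \<bullet> H \<le> 0"
      using eventually_at_right_less[of "0::real"]
    proof eventually_elim
      case (elim e)
      then show ?case
        using v G by (intro *) (auto simp: inner_diff_left)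
    qed
    ultimately show ?thesis
      by (auto dest: tendsto_upperbound)
  qed
  \<comment> \<open>\<open>v\<close> is the part of \<open>H\<close> orthogonal to \<open>G\<close>.
    Being an admissible test direction itself, it satisfies
    \<open>v \<bullet> v = v \<bullet> H \<le> 0\<close>. The direction \<open>- G\<close> then
    fixes the sign of \<open>\<kappa>\<close>.\<close>
  define \<kappa> where "\<kappa> = (H \<bullet> G) / (G \<bullet> G)"
  define v where "v = H - \<kappa> *\<^sub>R G"
  have "v \<bullet> G = 0"
    using G by (simp add: v_def \<kappa>_def inner_diff_left)
  moreover have "v \<bullet> v = v \<bullet> H - \<kappa> * (v \<bullet> G)"
    by (subst (2) v_def) (simp add: inner_diff_right)
  ultimately have "v \<bullet> v \<le> 0"
    using **[of v] by simp
  then have "v = 0"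
    by (metis inner_eq_zero_iff inner_ge_zero order_antisym)
  then have H_eq: "H = \<kappa> *\<^sub>R G"
    by (simp add: v_def)
  have "(- G) \<bullet> H \<le> 0"
    using G by (intro *) simp
  then have "0 \<le> \<kappa> * (G \<bullet> G)"
    by (simp add: H_eq)
  moreover have "0 < G \<bullet> G"
    using G by simp
  ultimately have "0 \<le> \<kappa>"
    by (simp add: zero_le_mult_iff)
  moreover have "\<kappa> \<noteq> 0"
    using \<open>H \<noteq> 0\<close> H_eq by auto
  ultimately show ?thesis
    unfolding N_eq H_eq by (simp add: divide_simps)
qed


section \<open>Gram matrices\<close>

lemma matrix_inv_eqI:
  fixes A B :: "real^'n^'n"
  assumes "A ** B = mat 1"
  shows "matrix_inv A = B"
proof -
  have BA: "B ** A = mat 1"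
    using assms by (rule matrix_left_right_inverse[THEN iffD1])
  have "A ** matrix_inv A = mat 1 \<and> matrix_inv A ** A = mat 1"
    unfolding matrix_inv_def by (rule someI[of _ B]) (simp add: assms BA)
  then show ?thesis
    by (metis BA matrix_mul_assoc matrix_mul_lid matrix_mul_rid)
qed

lemma linear_eq_sum_axis:
  fixes D :: "real^'d::finite \<Rightarrow> 'b::real_vector"
  assumes "linear D"
  shows "D w = (\<Sum>i\<in>UNIV. w $ i *\<^sub>R D (axis i 1))"
proof -
  have "D w = D (\<Sum>i\<in>UNIV. w $ i *\<^sub>R axis i 1)"
    by (simp add: basis_expansion flip: scalar_mult_eq_scaleR)
  then show ?thesis
    by (simp add: linear_sum[OF assms] linear_cmul[OF assms])
qed

text \<open>By injectivity the range of \<open>D\<close> has dimension \<open>CARD('d)\<close>, so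
  an orthonormal basis of it can be indexed by \<open>'d\<close> and pulled back. The
  \<open>w m\<close> form an orthonormal frame for the metric induced by \<open>D\<close>.\<close>

lemma orthonormal_frame_pullback:
  fixes D :: "real^'d::finite \<Rightarrow> 'b::euclidean_space"
  assumes D: "linear D" "inj D"
  obtains w :: "'d \<Rightarrow> real^'d" where "\<And>m k. D (w m) \<bullet> D (w k) = (if m = k then 1 else 0)"
proof -
  have sub: "subspace (range D)"
    using D(1) by (simp add: linear_subspace_image)
  obtain B where B: "B \<subseteq> range D" "pairwise orthogonal B" "\<And>x. x \<in> B \<Longrightarrow> norm x = 1"
    "card B = dim (range D)" "independent B"
    using orthonormal_basis_subspace[OF sub] by metis
  have "dim (range D) = CARD('d)"
    using dim_image_eq[OF D(1), of UNIV] D(2) by simp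
  then have "card (UNIV :: 'd set) = card B" "finite B"
    using B by (auto intro: independent_imp_finite)
  then obtain h where h: "bij_betw h (UNIV :: 'd set) B"
    using finite_same_card_bij[OF finite] by metis
  have hB: "h m \<in> B" for m
    using h by (auto simp: bij_betw_def)
  have inj: "h m = h k \<longleftrightarrow> m = k" for m k
    using h by (auto simp: bij_betw_def inj_eq)
  have Dh: "D (inv D (h m)) = h m" for m
    using B(1) hB by (meson f_inv_into_f subset_iff)
  show thesis
  proof
    fix m k
    show "D (inv D (h m)) \<bullet> D (inv D (h k)) = (if m = k then 1 else 0)"
      using B(2) B(3)[OF hB[of m]] hB inj[of m k]
      by (auto simp: Dh pairwise_def orthogonal_def dot_square_norm)
  qed
qed

text \<open>A metric trace can be computed in any orthonormal frame, by summing the quadratic form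
  of \<open>B\<close> over it. This turns the mean curvature into a sum of normal components of
  second directional derivatives.\<close>

lemma trace_matrix_inv_gram:
  fixes D :: "real^'d::finite \<Rightarrow> 'b::euclidean_space"
  assumes D: "linear D"
    and w: "\<And>m k :: 'd. D (w m) \<bullet> D (w k) = (if m = k then 1 else 0)"
  shows "trace (matrix_inv (\<chi> i k. D (axis i 1) \<bullet> D (axis k 1)) ** B) =
    (\<Sum>m\<in>UNIV. \<Sum>k\<in>UNIV. \<Sum>i\<in>UNIV. w m $ k * w m $ i * B $ i $ k)"
proof -
  define A :: "real^'d^'d" where "A = (\<chi> i k. D (axis i 1) \<bullet> D (axis k 1))"
  define R :: "real^'d^'d" where "R = (\<chi> m. w m)"
  \<comment> \<open>orthonormality of the \<open>D (w m)\<close> reads \<open>R A R\<^sup>T = 1\<close>, whence \<open>A\<^sup>-\<^sup>1 = R\<^sup>T R\<close>\<close>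
  have "(R ** A) ** transpose R = mat 1"
  proof -
    have "((R ** A) ** transpose R) $ m $ k = D (w m) \<bullet> D (w k)" for m k
    proof -
      have "D (w m) \<bullet> D (w k) =
        (\<Sum>p\<in>UNIV. \<Sum>i\<in>UNIV. w m $ i * (w k $ p * (D (axis i 1) \<bullet> D (axis p 1))))"
        unfolding linear_eq_sum_axis[OF D, of "w m"] linear_eq_sum_axis[OF D, of "w k"]
        by (simp add: inner_sum_left inner_sum_right sum_distrib_left mult_ac)
      then show ?thesis
        by (simp add: matrix_matrix_mult_def transpose_def R_def A_def sum_distrib_left
            sum_distrib_right mult_ac)
    qed
    then show ?thesis
      by (simp add: vec_eq_iff w mat_def)
  qed
  then have "transpose R ** (R ** A) = mat 1"
    by (rule matrix_left_right_inverse[THEN iffD1])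
  then have "(transpose R ** R) ** A = mat 1"
    by (simp add: matrix_mul_assoc)
  then have "A ** (transpose R ** R) = mat 1"
    by (rule matrix_left_right_inverse[THEN iffD1])
  then have inv: "matrix_inv A = transpose R ** R"
    by (rule matrix_inv_eqI)
  have "trace (matrix_inv A ** B) =
      (\<Sum>k\<in>UNIV. \<Sum>i\<in>UNIV. \<Sum>m\<in>UNIV. w m $ k * w m $ i * B $ i $ k)"
    by (simp add: inv trace_def matrix_matrix_mult_def transpose_def R_def sum_distrib_right)
  also have "\<dots> = (\<Sum>k\<in>UNIV. \<Sum>m\<in>UNIV. \<Sum>i\<in>UNIV. w m $ k * w m $ i * B $ i $ k)"
    by (rule sum.cong[OF refl], rule sum.swap)
  also have "\<dots> = (\<Sum>m\<in>UNIV. \<Sum>k\<in>UNIV. \<Sum>i\<in>UNIV. w m $ k * w m $ i * B $ i $ k)"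
    by (rule sum.swap)
  finally show ?thesis
    by (simp add: A_def)
qed


section \<open>Smooth maps\<close>

lemma Ck_on_subset: "Ck_on k f W \<Longrightarrow> V \<subseteq> W \<Longrightarrow> Ck_on k f V"
  by (induction k arbitrary: f) (auto intro: continuous_on_subset)

text \<open>The derivative of a smooth local extension serves for \<open>X\<close> within
  \<open>S\<close>; once some derivative exists, \<open>frechet_derivative\<close> selects
  one.\<close>

lemma smooth_on_has_derivative:
  assumes X: "smooth_on S X" and x: "x \<in> S"
  shows "(X has_derivative frechet_derivative X (at x within S)) (at x within S)"
proof -
  from X x obtain W g where W: "open W" "x \<in> W" and g: "\<And>k. Ck_on k g W"
    and eq: "\<And>y. y \<in> S \<inter> W \<Longrightarrow> g y = X y"
    unfolding smooth_on_def by meson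
  have "g differentiable at x"
    using g[of 1] W by simp
  then obtain g' where "(g has_derivative g') (at x within S)"
    unfolding differentiable_def by (blast intro: has_derivative_at_withinI)
  moreover obtain d where "d > 0" "ball x d \<subseteq> W"
    using W open_contains_ball by blast
  ultimately have "(X has_derivative g') (at x within S)"
    using x eq by (elim has_derivative_transform_within) (auto simp: dist_commute subset_eq)
  then show ?thesis
    by (metis differentiableI frechet_derivative_works)
qed

lemma smooth_on_imp_continuous_on: "smooth_on S X \<Longrightarrow> continuous_on S X"
  unfolding continuous_on_eq_continuous_within
  using smooth_on_has_derivative has_derivative_continuous by metis

text \<open>At interior points the local extension agrees with \<open>X\<close> on a full
  neighbourhood, so iterated derivatives within \<open>S\<close> become ordinary derivatives of
  \<open>g\<close>.\<close>

lemma smooth_on_interior: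
  assumes X: "smooth_on S X" and x: "x \<in> interior S"
  obtains W g where "open W" "x \<in> W" "W \<subseteq> S" "\<And>k. Ck_on k g W" "\<And>y. y \<in> W \<Longrightarrow> X y = g y"
proof -
  have "x \<in> S"
    using x interior_subset by blast
  with X obtain W g where W: "open W" "x \<in> W" and g: "\<And>k. Ck_on k g W"
    and eq: "\<And>y. y \<in> S \<inter> W \<Longrightarrow> g y = X y"
    unfolding smooth_on_def by meson
  show thesis
  proof (rule that)
    show "open (W \<inter> interior S)" "x \<in> W \<inter> interior S" "W \<inter> interior S \<subseteq> S"
      using W x interior_subset[of S] by auto
    then show "X y = g y" if "y \<in> W \<inter> interior S" for y
      using eq[of y] that by auto
    show "Ck_on k g (W \<inter> interior S)" for k
      using g by (rule Ck_on_subset) simp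
  qed
qed


section \<open>The maximum principle\<close>

text \<open>At a maximum the second derivative along every straight line in the chart is at most 0.
  Summed over the directions of an orthonormal frame, the terms with second derivatives of
  \<open>X\<close> give a multiple of the mean curvature and vanish, while the quadratic term leaves
  \<open>2 * \<epsilon> * CARD('d) > 0\<close>.\<close>

lemma minimal_no_interior_max:
  fixes X :: "real^'d::finite \<Rightarrow> real^'n::finite"
  assumes X: "smooth_on S X" and x: "x \<in> interior S"
    and inj: "inj (frechet_derivative X (at x within S))"
    and min: "\<And>\<nu>. unit_normal S X x \<nu> \<Longrightarrow> mean_curvature S X \<nu> x = 0"
    and \<epsilon>: "0 < \<epsilon>"
  shows "\<exists>y\<in>S. e \<bullet> X x + \<epsilon> * (X x \<bullet> X x) < e \<bullet> X y + \<epsilon> * (X y \<bullet> X y)"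
proof (rule ccontr)
  assume no: "\<not> ?thesis"
  obtain W g where W: "open W" "x \<in> W" "W \<subseteq> S" and g: "\<And>k. Ck_on k g W"
    and eq: "\<And>y. y \<in> W \<Longrightarrow> X y = g y"
    using smooth_on_interior[OF X x] by blast
  define f where "f = (\<lambda>y. e \<bullet> g y + \<epsilon> * (g y \<bullet> g y))"
  have max: "f y \<le> f x" if "y \<in> W" for y
  proof -
    have "e \<bullet> X y + \<epsilon> * (X y \<bullet> X y) \<le> e \<bullet> X x + \<epsilon> * (X x \<bullet> X x)"
      using no W that by (auto simp: not_less)
    then show ?thesis
      by (simp add: f_def eq that W)
  qed
  define D where "D = (\<lambda>y. frechet_derivative g (at y))"
  \<comment> \<open>\<open>P k\<close> is the \<open>k\<close>-th partial derivative of
    \<open>g\<close> and \<open>DP k\<close> its derivative at \<open>x\<close>; thus summing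
    \<open>w $ k *\<^sub>R DP k w\<close> over \<open>k\<close> gives the second derivative of
    \<open>g\<close> at \<open>x\<close> in the direction \<open>w\<close>.\<close>
  define P where "P = (\<lambda>k y. D y (axis k 1))"
  define DP where "DP = (\<lambda>k. frechet_derivative (P k) (at x))"
  have D: "(g has_derivative D y) (at y)" if "y \<in> W" for y
    using g[of "Suc 0"] that by (simp add: D_def flip: frechet_derivative_works)
  have at_W: "at y within S = at y" if "y \<in> W" for y
    using W that by (intro at_within_interior) (auto intro: interiorI)
  have DX: "frechet_derivative X (at y within S) = D y" if y: "y \<in> W" for y
    unfolding at_W[OF y]
    by (rule frechet_derivative_at[symmetric], rule has_derivative_transform_within_open[OF D[OF y] W(1) y])
      (simp add: eq)
  have PX: "partial_deriv S k X y = P k y" if "y \<in> W" for k y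
    using that by (simp add: partial_deriv_def DX P_def)
  have DP: "(P k has_derivative DP k) (at x)" for k
    using g[of "Suc (Suc 0)"] W by (simp add: P_def D_def DP_def flip: frechet_derivative_works)
  have DPX: "partial_deriv S i (partial_deriv S k X) x = DP k (axis i 1)" for i k
  proof -
    have "(partial_deriv S k X has_derivative DP k) (at x)"
      by (rule has_derivative_transform_within_open[OF DP W(1,2)]) (simp add: PX)
    then show ?thesis
      using W by (simp add: partial_deriv_def at_W flip: frechet_derivative_at)
  qed
  have lin: "linear (D x)"
    using D[OF W(2)] by (rule has_derivative_linear)
  \<comment> \<open>\<open>n\<close> is the gradient at \<open>g x\<close> of \<open>q \<mapsto> e \<bullet> q + \<epsilon>|q|\<^sup>2\<close>; at a maximum it is normal to the
    hypersurface, so minimality removes its contribution to the trace of the Hessian\<close>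
  define n where "n = e + (2 * \<epsilon>) *\<^sub>R g x"
  have f': "(f has_derivative (\<lambda>v. (e + (2 * \<epsilon>) *\<^sub>R g y) \<bullet> D y v)) (at y)" if "y \<in> W" for y
    unfolding f_def
    by (rule derivative_eq_intros D that refl)+
      (simp add: fun_eq_iff inner_add_left inner_commute algebra_simps)
  have "(\<lambda>v. n \<bullet> D x v) = (\<lambda>v. 0)"
    unfolding n_def
  proof (rule has_derivative_local_max[OF f'[OF W(2)]])
    show "\<forall>\<^sub>F y in at x. f y \<le> f x"
      using W max eventually_at_topological by blast
  qed
  then have normal: "n \<bullet> D x v = 0" for v
    by meson
  \<comment> \<open>Differentiating \<open>f\<close> twice along a line gives \<open>(e + 2
    \<epsilon> g) \<bullet> g'' + 2 \<epsilon> (g' \<bullet> g')\<close>, here evaluated at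
    \<open>x\<close>.\<close>
  have second: "n \<bullet> (\<Sum>k\<in>UNIV. w $ k *\<^sub>R DP k w) + 2 * \<epsilon> * (D x w \<bullet> D x w) \<le> 0" for w
  proof -
    let ?\<gamma> = "\<lambda>t::real. x + t *\<^sub>R w"
    have "open (?\<gamma> -` W)"
      using W by (intro open_vimage continuous_intros)
    moreover have "0 \<in> ?\<gamma> -` W"
      using W by simp
    ultimately obtain d where "d > 0" "ball 0 d \<subseteq> ?\<gamma> -` W"
      using open_contains_ball by blast
    then have d: "?\<gamma> t \<in> W" if "\<bar>t\<bar> < d" for t
      using that by (auto simp: subset_eq dist_norm)
    have \<gamma>: "(?\<gamma> has_derivative (\<lambda>s. s *\<^sub>R w)) (at t)" for t
      by (auto intro!: derivative_eq_intros)
    \<comment> \<open>The first derivative along the line is expanded in the partials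
      \<open>P k\<close>, whose derivatives at \<open>x\<close> are the \<open>DP k\<close>.\<close>
    define h' where "h' = (\<lambda>t. (e + (2 * \<epsilon>) *\<^sub>R g (?\<gamma> t)) \<bullet> (\<Sum>k\<in>UNIV. w $ k *\<^sub>R P k (?\<gamma> t)))"
    show ?thesis
    proof (rule DERIV2_nonpos_at_local_max[OF \<open>d > 0\<close>, of "\<lambda>t. f (?\<gamma> t)" h'])
      fix t :: real
      assume t: "\<bar>t\<bar> < d"
      show "f (?\<gamma> t) \<le> f (?\<gamma> 0)"
        using max[OF d[OF t]] by simp
      have Dw: "D (?\<gamma> t) (s *\<^sub>R w) = s *\<^sub>R (\<Sum>k\<in>UNIV. w $ k *\<^sub>R P k (?\<gamma> t))" for s
        using has_derivative_linear[OF D[OF d[OF t]]]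
        by (simp add: P_def linear_cmul flip: linear_eq_sum_axis)
      show "((\<lambda>t. f (?\<gamma> t)) has_real_derivative h' t) (at t)"
        using has_derivative_compose[OF \<gamma> f'[OF d[OF t]]]
        by (simp add: Dw has_field_derivative_def h'_def mult.commute[of _ "_ \<bullet> _"])
    next
      have x0: "x = ?\<gamma> 0" by simp
      have g\<gamma>: "((\<lambda>t. g (?\<gamma> t)) has_derivative (\<lambda>s. D x (s *\<^sub>R w))) (at 0)"
        using has_derivative_compose[OF \<gamma>[of 0], of g "D x"] D[OF W(2)] by simp
      have P\<gamma>: "((\<lambda>t. P k (?\<gamma> t)) has_derivative (\<lambda>s. DP k (s *\<^sub>R w))) (at 0)" for k
        using has_derivative_compose[OF \<gamma>[of 0], of "P k" "DP k"] DP[of k] by simp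
      have der: "(h' has_derivative (\<lambda>s. n \<bullet> (\<Sum>k\<in>UNIV. w $ k *\<^sub>R DP k (s *\<^sub>R w)) +
          ((2 * \<epsilon>) *\<^sub>R D x (s *\<^sub>R w)) \<bullet> (\<Sum>k\<in>UNIV. w $ k *\<^sub>R P k x))) (at 0)"
        unfolding h'_def n_def
        by (rule derivative_eq_intros g\<gamma> P\<gamma> refl)+ simp
      have "DP k (s *\<^sub>R w) = s *\<^sub>R DP k w" for k s
        using has_derivative_linear[OF DP[of k]] by (simp add: linear_cmul)
      moreover have "(\<Sum>k\<in>UNIV. w $ k *\<^sub>R P k x) = D x w"
        by (simp add: P_def flip: linear_eq_sum_axis[OF lin])
      ultimately show "(h' has_real_derivative
          n \<bullet> (\<Sum>k\<in>UNIV. w $ k *\<^sub>R DP k w) + 2 * \<epsilon> * (D x w \<bullet> D x w)) (at 0)"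
        unfolding has_field_derivative_def
        by (intro has_derivative_eq_rhs[OF der])
          (simp add: fun_eq_iff linear_cmul[OF lin] inner_sum_right sum_distrib_left algebra_simps)
    qed
  qed
  obtain w :: "'d \<Rightarrow> real^'d" where w: "\<And>m k. D x (w m) \<bullet> D x (w k) = (if m = k then 1 else 0)"
    using orthonormal_frame_pullback[OF lin inj[unfolded DX[OF W(2)]]] by blast
  \<comment> \<open>Up to the factor \<open>norm n\<close>, this is the mean curvature for the
    normal \<open>n /\<^sub>R norm n\<close>. If \<open>n = 0\<close> there is nothing to normalize,
    but the sum is trivially 0.\<close>
  have "(\<Sum>m\<in>UNIV. n \<bullet> (\<Sum>k\<in>UNIV. w m $ k *\<^sub>R DP k (w m))) = 0"
  proof (cases "n = 0")
    case False
    define \<nu> where "\<nu> = n /\<^sub>R norm n"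
    have n: "n = norm n *\<^sub>R \<nu>"
      using False by (simp add: \<nu>_def)
    have "unit_normal S X x \<nu>"
      using False normal W by (simp add: unit_normal_def \<nu>_def PX P_def inner_commute)
    from min[OF this] have
      "(\<Sum>m\<in>UNIV. \<Sum>k\<in>UNIV. \<Sum>i\<in>UNIV. w m $ k * w m $ i * (DP k (axis i 1) \<bullet> \<nu>)) = 0"
      using trace_matrix_inv_gram[OF lin w, of "second_fundamental_form S X \<nu> x"] W
      by (simp add: mean_curvature_def first_fundamental_form_def PX P_def)
        (simp add: second_fundamental_form_def DPX)
    moreover have "n \<bullet> (\<Sum>k\<in>UNIV. u $ k *\<^sub>R DP k u) =
      norm n * (\<Sum>k\<in>UNIV. \<Sum>i\<in>UNIV. u $ k * u $ i * (DP k (axis i 1) \<bullet> \<nu>))" for u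
    proof -
      have "DP k u = (\<Sum>i\<in>UNIV. u $ i *\<^sub>R DP k (axis i 1))" for k
        using has_derivative_linear[OF DP] by (rule linear_eq_sum_axis)
      then show ?thesis
        by (subst n) (simp add: inner_sum_right sum_distrib_left inner_commute mult_ac)
    qed
    ultimately show ?thesis
      by (simp flip: sum_distrib_left)
  qed simp
  \<comment> \<open>Each frame vector \<open>D x (w m)\<close> has length 1, so each direction
    contributes exactly \<open>2 * \<epsilon>\<close>.\<close>
  moreover have "(\<Sum>m\<in>UNIV. n \<bullet> (\<Sum>k\<in>UNIV. w m $ k *\<^sub>R DP k (w m)) + 2 * \<epsilon>) \<le> 0"
    using second[of "w _"] by (intro sum_nonpos) (simp add: w)
  ultimately have "2 * \<epsilon> * CARD('d) \<le> 0"
    by (simp add: sum.distrib mult.commute)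
  with \<epsilon> show False
    by (simp add: mult_le_0_iff)
qed

text \<open>The conormal is the image of some \<open>w\<close> pointing out of the half-space, so
  \<open>- w\<close> leads from \<open>x\<close> into \<open>S\<close>. If \<open>f' \<eta>\<close>
  were negative, \<open>f\<close> would increase along that ray.\<close>

lemma max_at_boundary_imp_conormal_nonneg:
  fixes X :: "real^'d::finite \<Rightarrow> real^'n::finite" and f :: "real^'n \<Rightarrow> real"
  assumes X: "smooth_on S X" and S: "openin (top_of_set (half_space j)) S"
    and x: "x \<in> S" "x $ j = 0" and \<eta>: "outward_unit_conormal j S X x \<eta>"
    and f: "(f has_derivative f') (at (X x))"
    and max: "\<And>y. y \<in> S \<Longrightarrow> f (X y) \<le> f (X x)"
  shows "0 \<le> f' \<eta>"
proof (rule ccontr)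
  assume neg: "\<not> 0 \<le> f' \<eta>"
  define D where "D = frechet_derivative X (at x within S)"
  obtain w where w: "w $ j < 0" "\<eta> = D w"
    using \<eta> by (auto simp: outward_unit_conormal_def D_def Let_def)
  have D: "(X has_derivative D) (at x within S)"
    unfolding D_def using X x(1) by (rule smooth_on_has_derivative)
  have "((\<lambda>y. f (X y)) has_derivative (\<lambda>v. f' (D v))) (at x within S)"
    using D f by (rule has_derivative_compose)
  moreover have "0 < f' (D (- w))"
    using neg w has_derivative_linear[OF D] has_derivative_linear[OF f]
    by (simp add: linear_neg not_le)
  ultimately obtain d where "d > 0"
    and d: "\<And>t. 0 < t \<Longrightarrow> t < d \<Longrightarrow> x + t *\<^sub>R (- w) \<in> S \<Longrightarrow> f (X x) < f (X (x + t *\<^sub>R (- w)))"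
    using has_derivative_pos_inc_direction[of "\<lambda>y. f (X y)" "\<lambda>v. f' (D v)" x S "- w"] by blast
  obtain V where V: "open V" "S = half_space j \<inter> V"
    using S by (auto simp: openin_open)
  have "((\<lambda>t. x + t *\<^sub>R (- w)) \<longlongrightarrow> x + 0 *\<^sub>R (- w)) (at_right 0)"
    by (intro tendsto_intros)
  then have "\<forall>\<^sub>F t in at_right 0. x + t *\<^sub>R (- w) \<in> V"
    using V x by (auto intro: topological_tendstoD)
  moreover have "\<forall>\<^sub>F t in at_right 0. t < d"
    using \<open>d > 0\<close> by (auto intro: eventually_at_rightI[of 0])
  ultimately have "\<forall>\<^sub>F t in at_right (0::real). False"
    using eventually_at_right_less[of "0::real"]
  proof eventually_elim
    case (elim t)
    then have "x + t *\<^sub>R (- w) \<in> S"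
      using V x w by (simp add: half_space_def mult_nonneg_nonpos)
    with d[of t] max[of "x + t *\<^sub>R (- w)"] elim show False by simp
  qed
  then show False by simp
qed

text \<open>On each chart domain \<open>\<phi>\<close> is the chart followed by its local
  parametrization, and these domains form an open cover. Continuity makes the image compact, which
  provides the maximum point later.\<close>

lemma immersed_hypersurface_continuous_map:
  assumes "immersed_hypersurface j M \<A> \<phi>"
  shows "continuous_map M euclidean \<phi>"
proof -
  have cover: "(\<Union>(U, \<psi>)\<in>\<A>. U) = topspace M" and chart: "\<And>c. c \<in> \<A> \<Longrightarrow> is_chart j M c"
    and smooth: "\<And>c. c \<in> \<A> \<Longrightarrow> smooth_on (chart_image c) (local_param \<phi> c)"
    using assms by (auto simp: immersed_hypersurface_def compact_smooth_manifold_def)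
  have cont: "continuous_map (subtopology M U) euclidean \<phi>" if c: "(U, \<psi>) \<in> \<A>" for U \<psi>
  proof -
    have U: "openin M U" and h: "homeomorphic_map (subtopology M U) (top_of_set (\<psi> ` U)) \<psi>"
      using chart[OF c] by (auto simp: is_chart_def)
    have "continuous_map (top_of_set (\<psi> ` U)) euclidean (\<phi> \<circ> inv_into U \<psi>)"
      using smooth_on_imp_continuous_on[OF smooth[OF c]]
      by (simp add: chart_image_def local_param_def)
    from continuous_map_compose[OF homeomorphic_imp_continuous_map[OF h] this]
    show ?thesis
    proof (rule continuous_map_eq)
      fix p assume "p \<in> topspace (subtopology M U)"
      moreover have "inj_on \<psi> U"
        using homeomorphic_imp_injective_map[OF h] openin_subset[OF U]
        by (simp add: Int_absorb1)
      ultimately show "((\<phi> \<circ> inv_into U \<psi>) \<circ> \<psi>) p = \<phi> p"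
        by simp
    qed
  qed
  show ?thesis
  proof (rule pasting_lemma[of \<A> M fst euclidean "\<lambda>_. \<phi>"])
    show "openin M (fst c)" if "c \<in> \<A>" for c
      using chart[OF that] by (auto simp: is_chart_def)
    show "continuous_map (subtopology M (fst c)) euclidean \<phi>" if "c \<in> \<A>" for c
      using cont[of "fst c" "snd c"] that by simp
    show "\<exists>c. c \<in> \<A> \<and> x \<in> fst c \<and> \<phi> x = \<phi> x" if "x \<in> topspace M" for x
      using that cover by fastforce
  qed auto
qed

section \<open>Contradiction at a global maximum\<close>

text \<open>\<open>e\<close> is a direction in which \<open>f\<close> decreases at a definite rate; the function
  maximized is \<open>e \<bullet> x + \<epsilon>|x|\<^sup>2\<close>.\<close>

lemma no_minimal_free_boundary_sublevel:
  fixes f :: "real^'n::finite \<Rightarrow> real" and \<phi> :: "'m \<Rightarrow> real^'n" and j :: "'d::finite"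
  assumes immersed: "immersed_hypersurface j M \<A> \<phi>"
    and boundary: "\<phi> ` manifold_boundary j \<A> \<subseteq> frontier {y. f y < 0}"
    and minimal: "minimal \<A> \<phi>"
    and free: "free_boundary j \<A> \<phi> {y. f y < 0}"
    and f: "\<And>q. GDERIV f q :> H q" and H: "continuous_on UNIV H"
    and e: "\<And>q. e \<bullet> H q \<le> - \<delta>" and \<delta>: "0 < \<delta>"
  shows False
proof -
  have cont_f: "continuous_on UNIV f"
    using f by (auto simp: gderiv_def continuous_on_eq_continuous_at intro: has_derivative_continuous)
  \<comment> \<open>By continuity \<open>f \<le> 0\<close> on the closure, and the set itself is
    open, so its frontier consists of zeros of \<open>f\<close>.\<close>
  have f0: "f q = 0" if "q \<in> frontier {y. f y < 0}" for q
  proof -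
    have "closed {y. f y \<le> 0}"
      using cont_f by (intro closed_Collect_le) auto
    then have "closure {y. f y < 0} \<subseteq> {y. f y \<le> 0}"
      by (intro closure_minimal) auto
    moreover have "open {y. f y < 0}"
      using cont_f by (intro open_Collect_less) auto
    ultimately show ?thesis
      using that unfolding frontier_def by (force simp: interior_open)
  qed
  have charts: "\<And>c. c \<in> \<A> \<Longrightarrow> is_chart j M c" and cover: "(\<Union>(U, \<psi>)\<in>\<A>. U) = topspace M"
    and "compact_space M" and "topspace M \<noteq> {}"
    and smooth: "\<And>c. c \<in> \<A> \<Longrightarrow> smooth_on (chart_image c) (local_param \<phi> c)"
    and inj: "\<And>c x. c \<in> \<A> \<Longrightarrow> x \<in> chart_image c \<Longrightarrow>
      inj (frechet_derivative (local_param \<phi> c) (at x within chart_image c))"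
    using immersed by (auto simp: immersed_hypersurface_def compact_smooth_manifold_def)
  define C where "C = \<phi> ` topspace M"
  have C: "compact C" "C \<noteq> {}"
    using image_compactin[OF _ immersed_hypersurface_continuous_map[OF immersed], of "topspace M"]
      \<open>compact_space M\<close> \<open>topspace M \<noteq> {}\<close>
    by (auto simp: C_def compact_space_def)
  obtain R where R: "R > 0" "\<And>q. q \<in> C \<Longrightarrow> norm q \<le> R"
    using compact_imp_bounded[OF C(1)] by (auto simp: bounded_pos)
  have "compact (H ` C)"
    using H C(1) by (auto intro: compact_continuous_image continuous_on_subset)
  then obtain K where K: "K > 0" "\<And>q. q \<in> C \<Longrightarrow> norm (H q) \<le> K"
    by (metis bounded_pos compact_imp_bounded imageI)
  \<comment> \<open>In the derivative of \<open>v\<close> along the conormal, \<open>e\<close>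
    contributes at most \<open>- (\<delta> / K)\<close> and the quadratic term at most
    \<open>2 * \<epsilon> * R\<close>. With this choice the latter is half of
    \<open>\<delta> / K\<close>, so the sum stays negative.\<close>
  define \<epsilon> where "\<epsilon> = \<delta> / (4 * K * R)"
  have \<epsilon>: "0 < \<epsilon>"
    using \<delta> K R by (simp add: \<epsilon>_def)
  define v where "v = (\<lambda>q. e \<bullet> q + \<epsilon> * (q \<bullet> q))"
  have "continuous_on C v"
    unfolding v_def by (intro continuous_intros)
  from continuous_attains_sup[OF C this] obtain p
    where p: "p \<in> topspace M" and max: "\<And>p'. p' \<in> topspace M \<Longrightarrow> v (\<phi> p') \<le> v (\<phi> p)"
    by (auto simp: C_def)
  obtain U \<psi> where c: "(U, \<psi>) \<in> \<A>" and "p \<in> U"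
    using p unfolding cover[symmetric] by blast
  define S where "S = chart_image (U, \<psi>)"
  define X where "X = local_param \<phi> (U, \<psi>)"
  have S: "S = \<psi> ` U" and X: "X = \<phi> \<circ> inv_into U \<psi>"
    by (simp_all add: S_def X_def chart_image_def local_param_def)
  have "openin M U" and ope: "openin (top_of_set (half_space j)) S"
    and h: "homeomorphic_map (subtopology M U) (top_of_set S) \<psi>"
    using charts[OF c] by (auto simp: is_chart_def S)
  have UM: "U \<subseteq> topspace M"
    using \<open>openin M U\<close> by (rule openin_subset)
  then have "inj_on \<psi> U"
    using homeomorphic_imp_injective_map[OF h] by (simp add: Int_absorb1)
  then have X\<psi>: "X (\<psi> p') = \<phi> p'" if "p' \<in> U" for p'
    using that by (simp add: X)
  have x: "\<psi> p \<in> S"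
    using \<open>p \<in> U\<close> by (simp add: S)
  have maxX: "v (X y) \<le> v (X (\<psi> p))" if "y \<in> S" for y
    using that max UM \<open>p \<in> U\<close> by (auto simp: S X\<psi>)
  have smX: "smooth_on S X"
    using smooth[OF c] by (simp add: S_def X_def)
  show False
  proof (cases "\<psi> p $ j = 0")
    case True
    then have "\<phi> p \<in> frontier {y. f y < 0}"
      using boundary c \<open>p \<in> U\<close> by (force simp: manifold_boundary_def)
    then have "f (\<phi> p) = 0"
      by (rule f0)
    \<comment> \<open>The free boundary condition makes the conormal the normalized gradient of
      \<open>f\<close>, along which \<open>v\<close> strictly decreases, against the boundary
      test.\<close>
    obtain \<eta> where \<eta>: "outward_unit_conormal j S X (\<psi> p) \<eta>"
      and N: "outward_unit_normal {y. f y < 0} (\<phi> p) \<eta>"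
      using free c \<open>p \<in> U\<close> True by (fastforce simp: free_boundary_def S_def X_def)
    have "H (\<phi> p) \<noteq> 0"
      using e[of "\<phi> p"] \<delta> by auto
    with N \<open>f (\<phi> p) = 0\<close> f have \<eta>_eq: "\<eta> = H (\<phi> p) /\<^sub>R norm (H (\<phi> p))"
      by (rule outward_unit_normal_sublevel)
    have pC: "\<phi> p \<in> C"
      using p by (simp add: C_def)
    have "(v has_derivative (\<lambda>u. e \<bullet> u + 2 * (\<epsilon> * (\<phi> p \<bullet> u)))) (at (X (\<psi> p)))"
      unfolding v_def X\<psi>[OF \<open>p \<in> U\<close>]
      by (rule derivative_eq_intros refl)+ (simp add: fun_eq_iff inner_commute)
    from max_at_boundary_imp_conormal_nonneg[OF smX ope x True \<eta> this maxX]
    have "0 \<le> e \<bullet> \<eta> + 2 * (\<epsilon> * (\<phi> p \<bullet> \<eta>))" .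
    moreover have "e \<bullet> \<eta> \<le> - (\<delta> / K)"
    proof -
      have "\<delta> / K \<le> \<delta> / norm (H (\<phi> p))"
        using \<delta> K(1) K(2)[OF pC] \<open>H (\<phi> p) \<noteq> 0\<close> by (intro divide_left_mono) auto
      also have "\<dots> \<le> - (e \<bullet> H (\<phi> p)) / norm (H (\<phi> p))"
        using e[of "\<phi> p"] by (intro divide_right_mono) auto
      finally show ?thesis
        by (simp add: \<eta>_eq divide_inverse mult.commute)
    qed
    moreover have "\<epsilon> * (\<phi> p \<bullet> \<eta>) \<le> \<epsilon> * R"
    proof -
      have "norm \<eta> = 1"
        using \<open>H (\<phi> p) \<noteq> 0\<close> by (simp add: \<eta>_eq)
      with norm_cauchy_schwarz[of "\<phi> p" \<eta>] R(2)[OF pC] \<epsilon> show ?thesis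
        by simp
    qed
    moreover have "4 * (\<epsilon> * R) = \<delta> / K"
      using R by (simp add: \<epsilon>_def)
    moreover have "0 < \<delta> / K"
      using \<delta> K by simp
    ultimately show False by linarith
  next
    case False
    \<comment> \<open>Off the bounding hyperplane the chart image contains a Euclidean neighbourhood
      of the point, so the interior maximum principle applies.\<close>
    obtain V where V: "open V" "S = half_space j \<inter> V"
      using ope by (auto simp: openin_open)
    have "\<psi> p \<in> V \<inter> {x. 0 < x $ j}"
      using False x V by (simp add: half_space_def)
    moreover have "open (V \<inter> {x. 0 < x $ j})"
      using V by (intro open_Int open_Collect_less continuous_intros)
    moreover have "V \<inter> {x. 0 < x $ j} \<subseteq> S"
      using V by (auto simp: half_space_def)
    ultimately have "\<psi> p \<in> interior S"
      by (blast intro: interiorI)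
    moreover have "mean_curvature S X \<nu> (\<psi> p) = 0" if "unit_normal S X (\<psi> p) \<nu>" for \<nu>
      using minimal c x that by (auto simp: minimal_def S_def X_def)
    moreover have "inj (frechet_derivative X (at (\<psi> p) within S))"
      using inj[OF c] x by (simp add: S_def X_def)
    ultimately obtain y where "y \<in> S" "v (X (\<psi> p)) < v (X y)"
      using minimal_no_interior_max[OF smX _ _ _ \<epsilon>, of "\<psi> p" e] unfolding v_def by blast
    with maxX show False
      by (auto simp: not_less dest: order.strict_trans1)
  qed
qed

section \<open>Application to the diagonal quadratic\<close>

lemma GDERIV_diagonal_quadratic:
  fixes a :: "'n::finite \<Rightarrow> real"
  shows "GDERIV (\<lambda>x. (\<Sum>i\<in>UNIV. a i * (x $ i)\<^sup>2) + b * x $ l + c) q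
    :> (\<chi> i. 2 * a i * q $ i) + b *\<^sub>R axis l 1"
  unfolding gderiv_def
  by (rule derivative_eq_intros bounded_linear.has_derivative[OF bounded_linear_vec_nth] refl)+
    (simp add: fun_eq_iff inner_add_right inner_vec_def[of _ "\<chi> i. _ i"] inner_axis mult_ac)

theorem theorem1:
  fixes F :: "real ^ 'n::finite \<Rightarrow> real"
    and a :: "'n \<Rightarrow> real" and b c :: real
    and l :: 'n
    and \<Omega> :: "(real ^ 'n) set"
  assumes "\<And>i. a i \<in> {-1, 0, 1}"
    and "\<And>x. F x = (\<Sum>i\<in>UNIV. a i * (x $ i)\<^sup>2) + b * x $ l + c"
    and "\<Omega> = {x. F x < 1} \<or> \<Omega> = {x. F x > 1}"
    and "a l = 0" and "b \<noteq> 0"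
  shows "\<not> (\<exists>(j :: 'd::finite) (M :: 'm topology) (\<A> :: ('m, 'd) chart set) (\<phi> :: 'm \<Rightarrow> real ^ 'n).
           immersed_hypersurface j M \<A> \<phi> \<and>
           \<phi> ` topspace M \<subseteq> closure \<Omega> \<and>
           \<phi> ` manifold_boundary j \<A> \<subseteq> frontier \<Omega> \<and>
           minimal \<A> \<phi> \<and>
           free_boundary j \<A> \<phi> \<Omega>)"
proof
  assume "\<exists>(j :: 'd) (M :: 'm topology) (\<A> :: ('m, 'd) chart set) (\<phi> :: 'm \<Rightarrow> real ^ 'n).
    immersed_hypersurface j M \<A> \<phi> \<and> \<phi> ` topspace M \<subseteq> closure \<Omega> \<and>
    \<phi> ` manifold_boundary j \<A> \<subseteq> frontier \<Omega> \<and> minimal \<A> \<phi> \<and> free_boundary j \<A> \<phi> \<Omega>"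
  then obtain j :: 'd and M :: "'m topology" and \<A> and \<phi> :: "'m \<Rightarrow> real ^ 'n"
    where \<phi>: "immersed_hypersurface j M \<A> \<phi>" "\<phi> ` manifold_boundary j \<A> \<subseteq> frontier \<Omega>"
      "minimal \<A> \<phi>" "free_boundary j \<A> \<phi> \<Omega>"
    by blast
  \<comment> \<open>Both possible \<open>\<Omega>\<close> are negativity sets of quadratics of the
    same shape, so one argument with general coefficients covers them.\<close>
  have absurd: False
    if \<Omega>: "\<Omega> = {x. (\<Sum>i\<in>UNIV. \<alpha> i * (x $ i)\<^sup>2) + \<beta> * x $ l + \<gamma> < 0}" and "\<alpha> l = 0" "\<beta> \<noteq> 0"
    for \<alpha> \<beta> \<gamma>
  proof (rule no_minimal_free_boundary_sublevel[OF \<phi>[unfolded \<Omega>] GDERIV_diagonal_quadratic])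
    show "continuous_on UNIV (\<lambda>q. (\<chi> i. 2 * \<alpha> i * q $ i) + \<beta> *\<^sub>R axis l 1)"
      by (intro continuous_intros)
    \<comment> \<open>Since \<open>\<alpha> l = 0\<close>, the \<open>l\<close>-component of the
      gradient is the constant \<open>\<beta>\<close>. The direction
      \<open>- \<beta> *\<^sub>R axis l 1\<close> therefore gives exactly
      \<open>- \<beta>\<^sup>2\<close>, whatever the sign of \<open>\<beta>\<close>.\<close>
    show "(- \<beta> *\<^sub>R axis l 1) \<bullet> ((\<chi> i. 2 * \<alpha> i * q $ i) + \<beta> *\<^sub>R axis l 1) \<le> - \<beta>\<^sup>2" for q
      using \<open>\<alpha> l = 0\<close> by (simp add: inner_axis' power2_eq_square)
    show "0 < \<beta>\<^sup>2"
      using \<open>\<beta> \<noteq> 0\<close> by simp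
  qed
  from assms(3) show False
  proof
    assume "\<Omega> = {x. F x < 1}"
    then show False
      using assms(4,5) by (intro absurd[of a b "c - 1"]) (auto simp: assms(2))
  next
    assume "\<Omega> = {x. F x > 1}"
    then show False
      \<comment> \<open>\<open>F x > 1\<close> is \<open>1 - F x < 0\<close>: negating the
        coefficients keeps the \<open>l\<close>-th one zero and the linear one nonzero.\<close>
      using assms(4,5) by (intro absurd[of "\<lambda>i. - a i" "- b" "1 - c"]) (auto simp: assms(2) sum_negf)
  qed
qed

end
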